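(* Let $k$ be an algebraically closed field of characteristic not equal to $2$ or $3$, such that $(a,b,c)=(1,-1,-1)$ satisfies the requirements in the definition of a three-dimensional Sklyanin algebra (equivalently, also $\operatorname{char}k\neq 7$). For the parameters $(a,b,c)=(1,-1,-1)$, the automorphism $\sigma_{1,-1,-1}$ has order $6$, and there exist $2$-dimensional irreducible representations of the three-dimensional Sklyanin algebra $S(1,-1,-1)$.
   Context: Three-dimensional Sklyanin algebra: $S(a,b,c)=k\{x,y,z\}/(ayz+bzy+cx^2,\ azx+bxz+cy^2,\ axy+byx+cz^2)$, where it is required that (1) $[a:b:c]\in\mathbb{P}^2_k\setminus\mathfrak{D}$ with $\mathfrak{D}=\{[0:0:1],[0:1:0],[1:0:0]\}\cup\{[a:b:c]\mid a^3=b^3=c^3=1\}$, and (2) $abc\neq0$ and $(3abc)^3\neq(a^3+b^3+c^3)^3$. $E=E_{abc}\subset\mathbb{P}^2$ is the smooth elliptic curve $(a^3+b^3+c^3)xyz-abc(x^3+y^3+z^3)=0$. The automorphism $\sigma=\sigma_{abc}$ of $E$ (induced by the shift functor on point modules of $S(a,b,c)$) is given explicitly by $\sigma([x:y:z])=[acy^2-b^2xz: bcx^2-a^2yz: abz^2-c^2xy]$ wherever this expression is defined; equivalently, $\sigma(p)$ is the unique point $q\in\mathbb{P}^2$ such that for $p=[x_1:y_1:z_1]$, $q=[x_2:y_2:z_2]$ one has $ay_1z_2+bz_1y_2+cx_1x_2=az_1x_2+bx_1z_2+cy_1y_2=ax_1y_2+by_1x_2+cz_1z_2=0$. An $n$-dimensional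 representation of a $k$-algebra $A$ is a ($k$-algebra) homomorphism $A\to \mathrm{Mat}_n(k)$; it is irreducible if it has no proper subrepresentation, i.e. the corresponding left $A$-module is simple. *)

theory Defs
  imports
    "HOL-Algebra.Bij"
    "HOL-Algebra.Multiplicative_Group"
    "HOL-Algebra.QuotRing"
    "HOL-Library.Poly_Mapping"
    "Jordan_Normal_Form.VS_Connect"
begin

section \<open>The projective plane\<close>

text \<open>Points of the plane are classes of nonzero coordinate triples; \<open>hpoint x y z\<close> is the
  point \<open>[x : y : z]\<close>.  \<open>hpoint 0 0 0\<close> is the empty set, hence not a point.\<close>

definition proj_rel :: "(('k::field \<times> 'k \<times> 'k) \<times> ('k \<times> 'k \<times> 'k)) set" where
  "proj_rel = {((x, y, z), (x', y', z')) | x y z x' y' z'.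
     (x, y, z) \<noteq> (0, 0, 0) \<and> (\<exists>t. t \<noteq> 0 \<and> x' = t * x \<and> y' = t * y \<and> z' = t * z)}"

definition proj_plane :: "('k::field \<times> 'k \<times> 'k) set set" where
  "proj_plane = (UNIV - {(0, 0, 0)}) // proj_rel"

definition hpoint :: "'k::field \<Rightarrow> 'k \<Rightarrow> 'k \<Rightarrow> ('k \<times> 'k \<times> 'k) set" where
  "hpoint x y z = proj_rel `` {(x, y, z)}"


section \<open>Automorphisms of plane curves\<close>

definition hom_poly_fun :: "nat \<Rightarrow> ('k::field \<Rightarrow> 'k \<Rightarrow> 'k \<Rightarrow> 'k) \<Rightarrow> bool" where
  "hom_poly_fun d F \<longleftrightarrow> (\<exists>coef :: nat \<Rightarrow> nat \<Rightarrow> 'k. \<forall>x y z.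
     F x y z = (\<Sum>i\<le>d. \<Sum>j\<le>d - i. coef i j * x ^ i * y ^ j * z ^ (d - i - j)))"

text \<open>Morphisms from a closed subset \<open>C\<close> to the plane: near every point of \<open>C\<close> the map is given by
  three homogeneous polynomials of the same degree without common zero at that point.\<close>

definition regular_map_on ::
  "('k::field \<times> 'k \<times> 'k) set set \<Rightarrow>
   (('k \<times> 'k \<times> 'k) set \<Rightarrow> ('k \<times> 'k \<times> 'k) set) \<Rightarrow> bool" where
  "regular_map_on C f \<longleftrightarrow> (\<forall>p\<in>C. \<exists>d F G H.
     hom_poly_fun d F \<and> hom_poly_fun d G \<and> hom_poly_fun d H \<and>
     (\<forall>(x, y, z)\<in>p. (F x y z, G x y z, H x y z) \<noteq> (0, 0, 0)) \<and>
     (\<forall>q\<in>C. \<forall>(x, y, z)\<in>q. (F x y z, G x y z, H x y z) \<noteq> (0, 0, 0) \<longrightarrow>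
        f q = hpoint (F x y z) (G x y z) (H x y z)))"

definition curve_aut ::
  "('k::field \<times> 'k \<times> 'k) set set \<Rightarrow>
   (('k \<times> 'k \<times> 'k) set \<Rightarrow> ('k \<times> 'k \<times> 'k) set) set" where
  "curve_aut C = {f \<in> Bij C. regular_map_on C f \<and> regular_map_on C (inv_into C f)}"


section \<open>Sklyanin parameters, the curve and its automorphism\<close>

definition sklyanin_excluded :: "('k::field \<times> 'k \<times> 'k) set set" where
  "sklyanin_excluded = {hpoint 0 0 1, hpoint 0 1 0, hpoint 1 0 0} \<union>
     {hpoint a b c | a b c. a ^ 3 = 1 \<and> b ^ 3 = 1 \<and> c ^ 3 = 1}"

definition sklyanin_params :: "'k::field \<Rightarrow> 'k \<Rightarrow> 'k \<Rightarrow> bool" where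
  "sklyanin_params a b c \<longleftrightarrow>
     hpoint a b c \<in> proj_plane - sklyanin_excluded \<and>
     a * b * c \<noteq> 0 \<and> (3 * a * b * c) ^ 3 \<noteq> (a ^ 3 + b ^ 3 + c ^ 3) ^ 3"

definition sklyanin_curve :: "'k::field \<Rightarrow> 'k \<Rightarrow> 'k \<Rightarrow> ('k \<times> 'k \<times> 'k) set set" where
  "sklyanin_curve a b c = {p \<in> proj_plane. \<forall>(x, y, z)\<in>p.
     (a ^ 3 + b ^ 3 + c ^ 3) * x * y * z - a * b * c * (x ^ 3 + y ^ 3 + z ^ 3) = 0}"

definition sklyanin_incident ::
  "'k::field \<Rightarrow> 'k \<Rightarrow> 'k \<Rightarrow> ('k \<times> 'k \<times> 'k) set \<Rightarrow> ('k \<times> 'k \<times> 'k) set \<Rightarrow> bool" where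
  "sklyanin_incident a b c p q \<longleftrightarrow> (\<forall>(x1, y1, z1)\<in>p. \<forall>(x2, y2, z2)\<in>q.
     a * y1 * z2 + b * z1 * y2 + c * x1 * x2 = 0 \<and>
     a * z1 * x2 + b * x1 * z2 + c * y1 * y2 = 0 \<and>
     a * x1 * y2 + b * y1 * x2 + c * z1 * z2 = 0)"

text \<open>On the open set where it is nonzero, the cross product of the first two linear forms in
  \<open>(x2, y2, z2)\<close> gives the formula
  \<open>[a c y^2 - b^2 x z : b c x^2 - a^2 y z : a b z^2 - c^2 x y]\<close>.
  The map is restricted to the curve (\<open>undefined\<close> elsewhere), as \<open>Bij\<close> requires.\<close>

definition sklyanin_sigma ::
  "'k::field \<Rightarrow> 'k \<Rightarrow> 'k \<Rightarrow> ('k \<times> 'k \<times> 'k) set \<Rightarrow> ('k \<times> 'k \<times> 'k) set" where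
  "sklyanin_sigma a b c = (\<lambda>p\<in>sklyanin_curve a b c.
     THE q. q \<in> proj_plane \<and> sklyanin_incident a b c p q)"


section \<open>The free algebra on three generators\<close>

datatype gen = Gen_x | Gen_y | Gen_z

text \<open>Words form the free monoid, written additively because \<open>Poly_Mapping\<close> turns finitely
  supported functions on an additive (not necessarily commutative) monoid into its monoid ring.\<close>

datatype word = Word (letters: "gen list")

instantiation word :: monoid_add
begin

definition zero_word :: word where "0 = Word []"

definition plus_word :: "word \<Rightarrow> word \<Rightarrow> word" where
  "u + v = Word (letters u @ letters v)"

instance
  by standard (simp_all add: zero_word_def plus_word_def)

end

type_synonym 'k free_alg = "word \<Rightarrow>\<^sub>0 'k"

definition free_scalar :: "'k::field \<Rightarrow> 'k free_alg" where
  "free_scalar t = Poly_Mapping.single 0 t"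

definition free_gen :: "gen \<Rightarrow> 'k::field free_alg" where
  "free_gen g = Poly_Mapping.single (Word [g]) 1"

abbreviation free_ring :: "'k::field free_alg ring" where
  "free_ring \<equiv> class_ring"


section \<open>Three-dimensional Sklyanin algebras\<close>

definition sklyanin_relations :: "'k::field \<Rightarrow> 'k \<Rightarrow> 'k \<Rightarrow> 'k free_alg set" where
  "sklyanin_relations a b c =
     (let x = free_gen Gen_x; y = free_gen Gen_y; z = free_gen Gen_z;
          a' = free_scalar a; b' = free_scalar b; c' = free_scalar c
      in {a' * y * z + b' * z * y + c' * x ^ 2,
          a' * z * x + b' * x * z + c' * y ^ 2,
          a' * x * y + b' * y * x + c' * z ^ 2})"

text \<open>\<open>genideal\<close> is the generated two-sided ideal.\<close>

definition sklyanin_ideal :: "'k::field \<Rightarrow> 'k \<Rightarrow> 'k \<Rightarrow> 'k free_alg set" where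
  "sklyanin_ideal a b c = genideal free_ring (sklyanin_relations a b c)"

definition sklyanin_alg :: "'k::field \<Rightarrow> 'k \<Rightarrow> 'k \<Rightarrow> 'k free_alg set ring" where
  "sklyanin_alg a b c = free_ring Quot sklyanin_ideal a b c"

definition sklyanin_scalar :: "'k::field \<Rightarrow> 'k \<Rightarrow> 'k \<Rightarrow> 'k \<Rightarrow> 'k free_alg set" where
  "sklyanin_scalar a b c t = sklyanin_ideal a b c +>\<^bsub>free_ring\<^esub> free_scalar t"


section \<open>Representations\<close>

text \<open>A \<open>k\<close>-algebra is given by a ring \<open>A\<close> and its structure map \<open>s\<close> from \<open>k\<close> to the centre of
  \<open>A\<close>; algebra homomorphisms are the unital ring homomorphisms commuting with structure maps.\<close>

definition matrix_representation ::
  "('a, 'm) ring_scheme \<Rightarrow> ('k::field \<Rightarrow> 'a) \<Rightarrow> nat \<Rightarrow> ('a \<Rightarrow> 'k mat) \<Rightarrow> bool" where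
  "matrix_representation A s n \<phi> \<longleftrightarrow>
     \<phi> \<in> Ring.ring_hom A (ring_mat TYPE('k) n ()) \<and> (\<forall>t. \<phi> (s t) = t \<cdot>\<^sub>m 1\<^sub>m n)"

definition irreducible_representation ::
  "('a, 'm) ring_scheme \<Rightarrow> ('k::field \<Rightarrow> 'a) \<Rightarrow> nat \<Rightarrow> ('a \<Rightarrow> 'k mat) \<Rightarrow> bool" where
  "irreducible_representation A s n \<phi> \<longleftrightarrow>
     matrix_representation A s n \<phi> \<and> n > 0 \<and>
     (\<forall>W. VectorSpace.subspace class_ring W (module_vec TYPE('k) n) \<and>
          (\<forall>r\<in>carrier A. \<forall>w\<in>W. \<phi> r *\<^sub>v w \<in> W) \<longrightarrow>
        W = {0\<^sub>v n} \<or> W = carrier_vec n)"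

end

theory Submission
  imports Defs
begin

text \<open>
  For the parameters \<open>(1, -1, -1)\<close> the three bilinear equations that relate \<open>p = (x, y, z)\<close> to
  \<open>q = \<sigma>(p) = (u, v, w)\<close> say that the cross product \<open>p \<times> q\<close> is the componentwise product
  \<open>(x u, y v, z w)\<close>.  The cross product is antisymmetric while the componentwise product is
  symmetric, and writing out the equations shows that \<open>(p, q)\<close> solves them exactly when
  \<open>(q, \<rho> p)\<close> does, where \<open>\<rho>(x, y, z) = (y, z, x)\<close> (\<open>incident_cyclic\<close>).  Hence \<open>\<sigma>\<^sup>2 = \<rho>\<close> on the
  curve.  So \<open>\<sigma>\<close> is bijective with inverse \<open>\<rho>\<^sup>2 \<sigma>\<close> and \<open>\<sigma>\<^sup>6 = \<rho>\<^sup>3 = 1\<close>, and the point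
  \<open>[0 : 1 : -1]\<close>, which neither \<open>\<sigma>\<^sup>2\<close> nor \<open>\<sigma>\<^sup>3\<close> fixes, shows that the order is exactly 6.

  For fixed \<open>p\<close> the equations are linear in \<open>q\<close>, with a \<open>3 \<times> 3\<close> matrix whose determinant is minus
  the equation of the curve.  The columns of its adjugate give three quadratic formulas for
  \<open>\<sigma>\<close>; in characteristic other than 2 they have no common zero (\<open>charts_cover\<close>), so that \<open>\<sigma>\<close> is
  a well-defined morphism.

  The defining relations of the algebra read \<open>[y, z] = x\<^sup>2\<close>, \<open>[z, x] = y\<^sup>2\<close>, \<open>[x, y] = z\<^sup>2\<close>.  In
  the quaternions with \<open>I\<^sup>2 = J\<^sup>2 = -1\<close> and \<open>K = I J\<close>, the elements \<open>1 + I\<close>, \<open>1 + J\<close>, \<open>1 + K\<close> satisfy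
  them, because \<open>[J, K] = 2 I = (1 + I)\<^sup>2\<close> and cyclically.  Over an algebraically closed field of
  characteristic other than 2 the quaternions are the full algebra of \<open>2 \<times> 2\<close> matrices, and this
  gives an irreducible representation (\<open>irreducible_representation_exists\<close>).
\<close>

section \<open>Homogeneous coordinates\<close>

lemma mem_hpoint_iff:
  "(x', y', z') \<in> hpoint x y z \<longleftrightarrow>
     (x, y, z) \<noteq> (0, 0, 0) \<and> (\<exists>t. t \<noteq> 0 \<and> x' = t * x \<and> y' = t * y \<and> z' = t * z)"
  by (auto simp: hpoint_def proj_rel_def)

lemma hpoint_scale:
  assumes "t \<noteq> 0"
  shows "hpoint (t * x) (t * y) (t * z) = hpoint x y z"
proof -
  have "(a, b, c) \<in> hpoint (t * x) (t * y) (t * z) \<longleftrightarrow> (a, b, c) \<in> hpoint x y z" for a b c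
  proof
    assume "(a, b, c) \<in> hpoint (t * x) (t * y) (t * z)"
    then obtain s where "s \<noteq> 0" "a = (s * t) * x" "b = (s * t) * y" "c = (s * t) * z"
        "(x, y, z) \<noteq> (0, 0, 0)"
      by (auto simp: mem_hpoint_iff mult.assoc)
    with assms show "(a, b, c) \<in> hpoint x y z"
      unfolding mem_hpoint_iff by (metis mult_eq_0_iff)
  next
    assume "(a, b, c) \<in> hpoint x y z"
    then obtain s where "s \<noteq> 0" "a = s * x" "b = s * y" "c = s * z" "(x, y, z) \<noteq> (0, 0, 0)"
      by (auto simp: mem_hpoint_iff)
    with assms show "(a, b, c) \<in> hpoint (t * x) (t * y) (t * z)"
      unfolding mem_hpoint_iff by (auto intro!: exI[of _ "s / t"])
  qed
  then show ?thesis by auto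
qed

lemma hpoint_self: "(x, y, z) \<noteq> (0, 0, 0) \<Longrightarrow> (x, y, z) \<in> hpoint x y z"
  unfolding mem_hpoint_iff by (auto intro!: exI[of _ 1])

text \<open>A homogeneous condition may be tested on a single representative of a point.\<close>

lemma ball_hpoint_invariant:
  assumes "(x, y, z) \<noteq> (0, 0, 0)" "\<And>t. t \<noteq> 0 \<Longrightarrow> P (t * x) (t * y) (t * z) \<longleftrightarrow> P x y z"
  shows "(\<forall>(a, b, c)\<in>hpoint x y z. P a b c) \<longleftrightarrow> P x y z"
proof
  assume "\<forall>(a, b, c)\<in>hpoint x y z. P a b c"
  from bspec[OF this hpoint_self[OF assms(1)]] show "P x y z" by simp
qed (auto simp: mem_hpoint_iff assms(2))

lemma proj_plane_iff:
  "p \<in> proj_plane \<longleftrightarrow> (\<exists>x y z. (x, y, z) \<noteq> (0, 0, 0) \<and> p = hpoint x y z)"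
  by (auto simp: proj_plane_def quotient_def hpoint_def)

lemma hpoint_in_proj_plane_iff: "hpoint x y z \<in> proj_plane \<longleftrightarrow> (x, y, z) \<noteq> (0, 0, 0)"
proof
  assume "hpoint x y z \<in> proj_plane"
  then obtain a b c where "(a, b, c) \<in> hpoint x y z" unfolding proj_plane_iff by (metis hpoint_self)
  then show "(x, y, z) \<noteq> (0, 0, 0)" unfolding mem_hpoint_iff by blast
qed (auto simp: proj_plane_iff)

text \<open>Two nonzero vectors with vanishing cross product are proportional.\<close>

lemma hpoint_eqI:
  assumes p: "(x, y, z) \<noteq> (0, 0, 0)" and q: "(u, v, w) \<noteq> (0, 0, 0)"
    and "x * v = y * u" "y * w = z * v" "z * u = x * w"
  shows "hpoint x y z = hpoint u v w"
proof -
  have "\<exists>t. u = t * x \<and> v = t * y \<and> w = t * z"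
  proof -
    consider "x \<noteq> 0" | "y \<noteq> 0" | "z \<noteq> 0" using p by auto
    then show ?thesis
    proof cases
      case 1 with assms(3-) show ?thesis by (intro exI[of _ "u / x"]) (simp add: field_simps)
    next
      case 2 with assms(3-) show ?thesis by (intro exI[of _ "v / y"]) (simp add: field_simps)
    next
      case 3 with assms(3-) show ?thesis by (intro exI[of _ "w / z"]) (simp add: field_simps)
    qed
  qed
  then obtain t where t: "u = t * x" "v = t * y" "w = t * z" by blast
  with q have "t \<noteq> 0" by auto
  with t show ?thesis by (simp add: hpoint_scale)
qed

definition cyclic_shift :: "('k \<times> 'k \<times> 'k) set \<Rightarrow> ('k \<times> 'k \<times> 'k) set" where
  "cyclic_shift p = (\<lambda>(x, y, z). (y, z, x)) ` p"

lemma cyclic_shift_hpoint: "cyclic_shift (hpoint x y z) = hpoint y z x"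
proof -
  have "(a, b, c) \<in> cyclic_shift (hpoint x y z) \<longleftrightarrow> (c, a, b) \<in> hpoint x y z" for a b c
    by (force simp: cyclic_shift_def)
  then have "(a, b, c) \<in> cyclic_shift (hpoint x y z) \<longleftrightarrow> (a, b, c) \<in> hpoint y z x" for a b c
    by (auto simp: mem_hpoint_iff)
  then show ?thesis by auto
qed

lemma cyclic_shift_cubed: "cyclic_shift (cyclic_shift (cyclic_shift p)) = p"
  by (force simp: cyclic_shift_def image_image case_prod_unfold)

section \<open>Admissibility of the parameters\<close>

lemma CHAR_not_2: "CHAR('k::field) \<noteq> 2 \<Longrightarrow> (2::'k) \<noteq> 0"
proof
  assume "CHAR('k) \<noteq> 2" "(2::'k) = 0"
  then have "of_nat 2 = (0::'k)" by simp
  then have "CHAR('k) dvd 2" by (simp only: of_nat_eq_0_iff_char_dvd)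
  then have "CHAR('k) = 1 \<or> CHAR('k) = 2" using two_is_prime_nat prime_nat_iff by blast
  with \<open>CHAR('k) \<noteq> 2\<close> show False by simp
qed

text \<open>Away from characteristic 2 the condition \<open>(3abc)\<^sup>3 \<noteq> (a\<^sup>3 + b\<^sup>3 + c\<^sup>3)\<^sup>3\<close> is the only one that can
  fail.  Here it reads \<open>27 \<noteq> -1\<close>, and \<open>28 = 2\<^sup>2 \<cdot> 7\<close>.\<close>

lemma params_iff:
  assumes two: "CHAR('k::field) \<noteq> 2"
  shows "sklyanin_params (1::'k) (-1) (-1) \<longleftrightarrow> CHAR('k) \<noteq> 7"
proof -
  have two': "(2::'k) \<noteq> 0" using two by (rule CHAR_not_2)
  have self: "(1, -1, -1::'k) \<in> hpoint 1 (-1) (-1)" by (rule hpoint_self) simp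
  \<comment> \<open>A representative \<open>(a, b, c)\<close> with unit cubes differs from \<open>(1, -1, -1)\<close> by a scalar \<open>t\<close> whose
    cube would have to be both \<open>1\<close> and \<open>-1\<close>.\<close>
  have no_cubes: "hpoint 1 (-1) (-1) \<noteq> hpoint a b c" if cubes: "a ^ 3 = 1" "b ^ 3 = 1" for a b c :: 'k
  proof
    assume "hpoint 1 (-1) (-1) = hpoint a b c"
    with self obtain t where "1 = t * a" "-1 = t * b" by (auto simp: mem_hpoint_iff)
    then have "1 ^ 3 = t ^ 3 * a ^ 3" "(-1) ^ 3 = t ^ 3 * b ^ 3" by (simp_all flip: power_mult_distrib)
    with cubes have "(1::'k) = -1" by simp
    with two' show False by (simp add: eq_neg_iff_add_eq_0)
  qed
  have "(1, -1, -1::'k) \<notin> hpoint 0 0 1 \<union> hpoint 0 1 0 \<union> hpoint 1 0 0"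
    by (simp add: mem_hpoint_iff)
  then have "hpoint 1 (-1) (-1::'k) \<notin> {hpoint 0 0 1, hpoint 0 1 0, hpoint 1 0 0}"
    using self by (metis UnCI insertE singletonD)
  then have "hpoint 1 (-1) (-1::'k) \<in> proj_plane - sklyanin_excluded"
    using no_cubes unfolding sklyanin_excluded_def hpoint_in_proj_plane_iff Diff_iff Un_iff by simp
  then have "sklyanin_params (1::'k) (-1) (-1) \<longleftrightarrow> (27::'k) \<noteq> -1"
    by (simp add: sklyanin_params_def)
  also have "\<dots> \<longleftrightarrow> of_nat 28 \<noteq> (0::'k)" by (simp add: eq_neg_iff_add_eq_0)
  also have "\<dots> \<longleftrightarrow> \<not> CHAR('k) dvd 28" by (simp only: of_nat_eq_0_iff_char_dvd)
  also have "\<dots> \<longleftrightarrow> CHAR('k) \<noteq> 7"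
  proof -
    have "CHAR('k) = 7" if dvd: "CHAR('k) dvd 28"
    proof -
      have "CHAR('k) > 0" using dvd by (auto intro: Nat.gr0I)
      then have prime: "prime CHAR('k)" by (rule prime_CHAR_semidom)
      have "CHAR('k) dvd 2 * (2 * 7)" using dvd by simp
      then have "CHAR('k) dvd 2 \<or> CHAR('k) dvd 7" using prime prime_dvd_mult_iff by blast
      moreover have "prime (7::nat)" by simp
      ultimately show ?thesis using prime two two_is_prime_nat primes_dvd_imp_eq by blast
    qed
    then show ?thesis by auto
  qed
  finally show ?thesis .
qed

section \<open>Incidence as a cross product\<close>

text \<open>The vanishing of the three bilinear forms: the cross product of \<open>(x, y, z)\<close> and \<open>(u, v, w)\<close>
  equals their componentwise product.\<close>

definition incident_coords :: "'k::field \<Rightarrow> 'k \<Rightarrow> 'k \<Rightarrow> 'k \<Rightarrow> 'k \<Rightarrow> 'k \<Rightarrow> bool" where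
  "incident_coords x y z u v w \<longleftrightarrow>
     y * w - z * v = x * u \<and> z * u - x * w = y * v \<and> x * v - y * u = z * w"

definition curve_coords :: "'k::field \<Rightarrow> 'k \<Rightarrow> 'k \<Rightarrow> bool" where
  "curve_coords x y z \<longleftrightarrow> x ^ 3 + y ^ 3 + z ^ 3 + x * y * z = 0"

text \<open>The key symmetry: the equations for \<open>(q, \<rho> p)\<close> are those for \<open>(p, q)\<close> up to order and
  rearrangement.  It is responsible for \<open>\<sigma>\<^sup>2 = \<rho>\<close>.\<close>

lemma incident_cyclic: "incident_coords u v w y z x \<longleftrightarrow> incident_coords x y z u v w"
  by (auto simp: incident_coords_def algebra_simps)

lemma incident_scale:
  assumes "s \<noteq> 0" "t \<noteq> 0"
  shows "incident_coords (s * x) (s * y) (s * z) (t * u) (t * v) (t * w) \<longleftrightarrow>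
    incident_coords x y z u v w"
proof -
  have "s * a * (t * b) - s * c * (t * d) = s * e * (t * f) \<longleftrightarrow> a * b - c * d = e * f"
    for a b c d e f
  proof -
    have "s * a * (t * b) - s * c * (t * d) = (s * t) * (a * b - c * d)"
         "s * e * (t * f) = (s * t) * (e * f)" by (simp_all add: algebra_simps)
    with assms show ?thesis by simp
  qed
  then show ?thesis unfolding incident_coords_def by simp
qed

text \<open>The equations are also invariant under the simultaneous cyclic shift of both points, which
  turns each computation below into one for a single coordinate or a single chart.\<close>

lemma incident_rotate: "incident_coords y z x v w u \<longleftrightarrow> incident_coords x y z u v w"
  by (auto simp: incident_coords_def algebra_simps)

lemma curve_coords_rotate: "curve_coords y z x \<longleftrightarrow> curve_coords x y z"
  by (simp add: curve_coords_def algebra_simps)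

text \<open>A nontrivial solution \<open>q\<close> of the linear system forces its determinant, which is minus the
  cubic, to vanish.\<close>

lemma incident_imp_curve:
  assumes "(u, v, w) \<noteq> (0, 0, 0)" "incident_coords x y z u v w"
  shows "curve_coords x y z"
proof -
  have first: "a * (b ^ 3 + c ^ 3 + d ^ 3 + b * c * d) = 0" if "incident_coords b c d a e f"
    for a b c d e f :: 'a
  proof -
    \<comment> \<open>The coefficients are the entries of a row of the adjugate matrix.\<close>
    have "a * (b ^ 3 + c ^ 3 + d ^ 3 + b * c * d) = (b^2 + c*d) * (b*a - (c*f - d*e))
        + (b*c - d^2) * (c*e - (d*a - b*f)) + (c^2 + b*d) * (d*f - (b*e - c*a))"
      by (simp add: algebra_simps power2_eq_square power3_eq_cube)
    with that show ?thesis by (simp add: incident_coords_def)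
  qed
  have "incident_coords y z x v w u" "incident_coords z x y w u v"
    using assms(2) by (simp_all add: incident_rotate)
  with assms(2) have "u * (x ^ 3 + y ^ 3 + z ^ 3 + x * y * z) = 0"
    "v * (y ^ 3 + z ^ 3 + x ^ 3 + y * z * x) = 0" "w * (z ^ 3 + x ^ 3 + y ^ 3 + z * x * y) = 0"
    by (blast intro: first)+
  with assms(1) show ?thesis by (auto simp: curve_coords_def ac_simps)
qed

text \<open>The cross product of the first two rows of the linear system annihilates these rows
  identically, and its product with the third row is the determinant.\<close>

lemma incident_chart:
  assumes "curve_coords x y z"
  shows "incident_coords x y z (y^2 + x*z) (y*z - x^2) (z^2 + x*y)"
proof -
  have "x * (y*z - x^2) - y * (y^2 + x*z) - z * (z^2 + x*y) = - (x^3 + y^3 + z^3 + x*y*z)"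
    by (simp add: algebra_simps power2_eq_square power3_eq_cube)
  with assms have "x * (y*z - x^2) - y * (y^2 + x*z) = z * (z^2 + x*y)"
    by (simp add: curve_coords_def)
  then show ?thesis
    by (simp add: incident_coords_def algebra_simps power2_eq_square)
qed

text \<open>Shifting the first chart cyclically yields the cross products of the other pairs of rows.\<close>

lemma incident_charts:
  assumes "curve_coords x y z"
  shows "incident_coords x y z (y^2 + x*z) (y*z - x^2) (z^2 + x*y)"
    and "incident_coords x y z (x^2 + y*z) (z^2 + x*y) (x*z - y^2)"
    and "incident_coords x y z (x*y - z^2) (y^2 + x*z) (x^2 + y*z)"
proof -
  show "incident_coords x y z (y^2 + x*z) (y*z - x^2) (z^2 + x*y)"
    by (rule incident_chart[OF assms])
  have "curve_coords y z x" "curve_coords z x y" using assms by (simp_all add: curve_coords_rotate)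
  from this[THEN incident_chart]
  show "incident_coords x y z (x^2 + y*z) (z^2 + x*y) (x*z - y^2)"
    and "incident_coords x y z (x*y - z^2) (y^2 + x*z) (x^2 + y*z)"
    by (simp_all add: incident_rotate mult.commute)
qed

text \<open>If all charts vanish, then differences of two of their entries give \<open>2x\<^sup>2 = 2y\<^sup>2 = 2z\<^sup>2 = 0\<close>.\<close>

lemma charts_cover:
  assumes "(2::'k::field) \<noteq> 0" and p: "(x, y, z) \<noteq> (0, 0, 0::'k)"
  shows "(y^2 + x*z, y*z - x^2, z^2 + x*y) \<noteq> (0, 0, 0) \<or>
    (x^2 + y*z, z^2 + x*y, x*z - y^2) \<noteq> (0, 0, 0) \<or>
    (x*y - z^2, y^2 + x*z, x^2 + y*z) \<noteq> (0, 0, 0)"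
proof (rule ccontr)
  assume "\<not> ?thesis"
  then have "y^2 + x*z = 0" "y*z - x^2 = 0" "z^2 + x*y = 0" "x^2 + y*z = 0"
    "x*z - y^2 = 0" "x*y - z^2 = 0" by auto
  moreover have "2 * x^2 = (x^2 + y*z) - (y*z - x^2)" "2 * y^2 = (y^2 + x*z) - (x*z - y^2)"
    "2 * z^2 = (z^2 + x*y) - (x*y - z^2)" by simp_all
  ultimately have "2 * x^2 = 0" "2 * y^2 = 0" "2 * z^2 = 0" by (metis diff_0_right)+
  with assms show False by simp
qed

text \<open>A solution \<open>q\<close> is orthogonal to the first two rows \<open>r\<close>, \<open>s\<close> of the system, so
  \<open>q \<times> (r \<times> s) = (q \<cdot> s) r - (q \<cdot> r) s = 0\<close>: the solution is parallel to the chart.\<close>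

lemma incident_cross_chart:
  assumes "incident_coords x y z u v w"
  shows "u * (y*z - x^2) = v * (y^2 + x*z)" "v * (z^2 + x*y) = w * (y*z - x^2)"
    "w * (y^2 + x*z) = u * (z^2 + x*y)"
proof -
  define e1 e2 where "e1 = y*w - z*v - x*u" and "e2 = z*u - x*w - y*v"
  have "u * (y*z - x^2) - v * (y^2 + x*z) = y * e2 + x * e1"
    "v * (z^2 + x*y) - w * (y*z - x^2) = - x * e2 - z * e1"
    "w * (y^2 + x*z) - u * (z^2 + x*y) = - z * e2 + y * e1"
    by (simp_all add: e1_def e2_def algebra_simps power2_eq_square)
  moreover have "e1 = 0" "e2 = 0" using assms by (simp_all add: e1_def e2_def incident_coords_def)
  ultimately show "u * (y*z - x^2) = v * (y^2 + x*z)" "v * (z^2 + x*y) = w * (y*z - x^2)"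
    "w * (y^2 + x*z) = u * (z^2 + x*y)" by simp_all
qed

lemma incident_eq_chart:
  assumes q: "(u, v, w) \<noteq> (0, 0, 0)" "incident_coords x y z u v w"
  shows "(y^2 + x*z, y*z - x^2, z^2 + x*y) \<noteq> (0, 0, 0) \<Longrightarrow>
      hpoint u v w = hpoint (y^2 + x*z) (y*z - x^2) (z^2 + x*y)"
    and "(x^2 + y*z, z^2 + x*y, x*z - y^2) \<noteq> (0, 0, 0) \<Longrightarrow>
      hpoint u v w = hpoint (x^2 + y*z) (z^2 + x*y) (x*z - y^2)"
    and "(x*y - z^2, y^2 + x*z, x^2 + y*z) \<noteq> (0, 0, 0) \<Longrightarrow>
      hpoint u v w = hpoint (x*y - z^2) (y^2 + x*z) (x^2 + y*z)"
proof -
  have inc: "incident_coords y z x v w u" "incident_coords z x y w u v"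
    using q(2) by (simp_all add: incident_rotate)
  show "(y^2 + x*z, y*z - x^2, z^2 + x*y) \<noteq> (0, 0, 0) \<Longrightarrow>
      hpoint u v w = hpoint (y^2 + x*z) (y*z - x^2) (z^2 + x*y)"
    using incident_cross_chart[OF q(2)] q(1) by (intro hpoint_eqI) simp_all
  show "(x^2 + y*z, z^2 + x*y, x*z - y^2) \<noteq> (0, 0, 0) \<Longrightarrow>
      hpoint u v w = hpoint (x^2 + y*z) (z^2 + x*y) (x*z - y^2)"
    using incident_cross_chart[OF inc(1)] q(1) by (intro hpoint_eqI) (simp_all add: mult.commute)
  show "(x*y - z^2, y^2 + x*z, x^2 + y*z) \<noteq> (0, 0, 0) \<Longrightarrow>
      hpoint u v w = hpoint (x*y - z^2) (y^2 + x*z) (x^2 + y*z)"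
    using incident_cross_chart[OF inc(2)] q(1) by (intro hpoint_eqI) (simp_all add: mult.commute)
qed

lemma incident_unique:
  assumes two: "(2::'k::field) \<noteq> 0" and p: "(x, y, z) \<noteq> (0, 0, 0::'k)"
    and q: "(u, v, w) \<noteq> (0, 0, 0)" "incident_coords x y z u v w"
    and q': "(u', v', w') \<noteq> (0, 0, 0)" "incident_coords x y z u' v' w'"
  shows "hpoint u v w = hpoint u' v' w'"
  using charts_cover[OF two p] incident_eq_chart[OF q] incident_eq_chart[OF q'] by argo

lemma curve_coords_scale:
  assumes "t \<noteq> 0"
  shows "curve_coords (t * x) (t * y) (t * z) \<longleftrightarrow> curve_coords x y z"
proof -
  have "(t*x)^3 + (t*y)^3 + (t*z)^3 + t*x * (t*y) * (t*z) = t ^ 3 * (x^3 + y^3 + z^3 + x*y*z)"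
    by (simp add: algebra_simps power3_eq_cube)
  with assms show ?thesis by (simp add: curve_coords_def)
qed

lemma sklyanin_curve_iff:
  "hpoint x y z \<in> sklyanin_curve 1 (-1) (-1) \<longleftrightarrow> (x, y, z) \<noteq> (0, 0, 0) \<and> curve_coords x y z"
proof -
  have "(1 ^ 3 + (-1) ^ 3 + (-1) ^ 3) * a * b * c - 1 * (-1) * (-1) * (a ^ 3 + b ^ 3 + c ^ 3) = 0
      \<longleftrightarrow> curve_coords a b c" for a b c :: 'a
  proof -
    have "(1 ^ 3 + (-1) ^ 3 + (-1) ^ 3) * a * b * c - 1 * (-1) * (-1) * (a ^ 3 + b ^ 3 + c ^ 3)
      = - (a ^ 3 + b ^ 3 + c ^ 3 + a * b * c)" by simp
    then show ?thesis unfolding curve_coords_def by (simp only: neg_equal_0_iff_equal)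
  qed
  then have "hpoint x y z \<in> sklyanin_curve 1 (-1) (-1) \<longleftrightarrow>
      (x, y, z) \<noteq> (0, 0, 0) \<and> (\<forall>(a, b, c)\<in>hpoint x y z. curve_coords a b c)"
    unfolding sklyanin_curve_def mem_Collect_eq hpoint_in_proj_plane_iff by simp
  then show ?thesis
    using ball_hpoint_invariant[of x y z curve_coords] curve_coords_scale by blast
qed

lemma sklyanin_curveE:
  assumes "p \<in> sklyanin_curve 1 (-1) (-1)"
  obtains x y z where "p = hpoint x y z" "(x, y, z) \<noteq> (0, 0, 0)" "curve_coords x y z"
proof -
  from assms obtain x y z where "p = hpoint x y z"
    by (auto simp: sklyanin_curve_def proj_plane_iff)
  with assms that show thesis by (auto simp: sklyanin_curve_iff)
qed

lemma sklyanin_incident_hpoint: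
  assumes p: "(x, y, z) \<noteq> (0, 0, 0)" and q: "(u, v, w) \<noteq> (0, 0, 0)"
  shows "sklyanin_incident 1 (-1) (-1) (hpoint x y z) (hpoint u v w) \<longleftrightarrow>
    incident_coords x y z u v w"
proof -
  have "1 * b * f + -1 * c * e + -1 * a * d = 0 \<and> 1 * c * d + -1 * a * f + -1 * b * e = 0 \<and>
      1 * a * e + -1 * b * d + -1 * c * f = 0 \<longleftrightarrow> incident_coords a b c d e f" for a b c d e f :: 'a
    by (auto simp: incident_coords_def algebra_simps)
  then have "sklyanin_incident 1 (-1) (-1) (hpoint x y z) (hpoint u v w) \<longleftrightarrow>
    (\<forall>(a, b, c)\<in>hpoint x y z. \<forall>(d, e, f)\<in>hpoint u v w. incident_coords a b c d e f)"
    unfolding sklyanin_incident_def by simp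
  also have "\<dots> \<longleftrightarrow> (\<forall>(d, e, f)\<in>hpoint u v w. incident_coords x y z d e f)"
    by (intro ball_hpoint_invariant p) (simp add: incident_scale[of _ 1, simplified])
  also have "\<dots> \<longleftrightarrow> incident_coords x y z u v w"
    by (intro ball_hpoint_invariant q) (simp add: incident_scale[of 1, simplified])
  finally show ?thesis .
qed

section \<open>The automorphism and its order\<close>

lemma sigma_eqI:
  assumes two: "(2::'k::field) \<noteq> 0" and p: "(x, y, z) \<noteq> (0, 0, 0::'k)"
    and q: "(u, v, w) \<noteq> (0, 0, 0)" "incident_coords x y z u v w"
  shows "sklyanin_sigma 1 (-1) (-1) (hpoint x y z) = hpoint u v w"
proof -
  have "hpoint x y z \<in> sklyanin_curve 1 (-1) (-1)"
    using p incident_imp_curve[OF q] by (simp add: sklyanin_curve_iff)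
  moreover have "(THE q. q \<in> proj_plane \<and> sklyanin_incident 1 (-1) (-1) (hpoint x y z) q)
      = hpoint u v w"
  proof (rule the_equality)
    show "hpoint u v w \<in> proj_plane \<and> sklyanin_incident 1 (-1) (-1) (hpoint x y z) (hpoint u v w)"
      using p q by (auto simp: proj_plane_iff sklyanin_incident_hpoint)
    fix q' assume "q' \<in> proj_plane \<and> sklyanin_incident 1 (-1) (-1) (hpoint x y z) q'"
    then obtain u' v' w' where "q' = hpoint u' v' w'" "(u', v', w') \<noteq> (0, 0, 0)"
      "incident_coords x y z u' v' w'"
      using p by (auto simp: proj_plane_iff sklyanin_incident_hpoint)
    then show "q' = hpoint u v w" using incident_unique[OF two p] q by metis
  qed
  ultimately show ?thesis by (simp add: sklyanin_sigma_def)
qed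

lemma sigma_exists:
  assumes two: "(2::'k::field) \<noteq> 0" and "p \<in> sklyanin_curve (1::'k) (-1) (-1)"
  obtains x y z u v w where "p = hpoint x y z" "(x, y, z) \<noteq> (0, 0, 0)"
    "(u, v, w) \<noteq> (0, 0, 0)" "incident_coords x y z u v w"
    "sklyanin_sigma 1 (-1) (-1) p = hpoint u v w"
proof -
  from assms(2) obtain x y z where p: "p = hpoint x y z" "(x, y, z) \<noteq> (0, 0, 0)" "curve_coords x y z"
    by (rule sklyanin_curveE)
  obtain u v w where q: "(u, v, w) \<noteq> (0, 0, 0)" "incident_coords x y z u v w"
    using charts_cover[OF two p(2)] incident_charts[OF p(3)] by metis
  from that[OF p(1,2) q] sigma_eqI[OF two p(2) q] p(1) show thesis by simp
qed

context
  fixes C :: "('k::field \<times> 'k \<times> 'k) set set" and \<sigma>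
  assumes two: "(2::'k) \<noteq> 0"
  defines "C \<equiv> sklyanin_curve (1::'k) (-1) (-1)" and "\<sigma> \<equiv> sklyanin_sigma (1::'k) (-1) (-1)"
begin

lemma sigma_sigma:
  assumes "p \<in> C"
  shows "\<sigma> p \<in> C" "\<sigma> (\<sigma> p) = cyclic_shift p"
proof -
  obtain x y z u v w where *: "p = hpoint x y z" "(x, y, z) \<noteq> (0, 0, 0)"
    "(u, v, w) \<noteq> (0, 0, 0)" "incident_coords x y z u v w"
    "\<sigma> p = hpoint u v w"
    using sigma_exists[OF two] assms unfolding C_def \<sigma>_def by metis
  have inc: "incident_coords u v w y z x" using *(4) by (rule incident_cyclic[THEN iffD2])
  have nz: "(y, z, x) \<noteq> (0, 0, 0)" using *(2) by auto
  show "\<sigma> p \<in> C" using * incident_imp_curve[OF nz inc] by (simp add: C_def sklyanin_curve_iff)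
  show "\<sigma> (\<sigma> p) = cyclic_shift p"
    using sigma_eqI[OF two *(3) nz inc] *(5) by (simp add: *(1) cyclic_shift_hpoint flip: \<sigma>_def)
qed

text \<open>Since \<open>\<rho> = \<sigma>\<^sup>2\<close> commutes with \<open>\<sigma>\<close>, the map \<open>\<rho>\<^sup>2 \<sigma>\<close> is a right inverse of \<open>\<sigma>\<close>.\<close>

lemma sigma_inverse:
  assumes "p \<in> C"
  shows "\<sigma> (cyclic_shift (cyclic_shift (\<sigma> p))) = p" "cyclic_shift (cyclic_shift (\<sigma> p)) \<in> C"
  using assms sigma_sigma cyclic_shift_cubed by (metis, metis)

lemma sigma_bij: "\<sigma> \<in> Bij C"
proof -
  have "inj_on \<sigma> C"
    by (intro inj_onI) (metis sigma_sigma cyclic_shift_cubed)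
  moreover have "\<sigma> ` C = C" using sigma_sigma(1) sigma_inverse by (auto simp: image_iff) metis
  ultimately show ?thesis
    by (auto simp: Bij_def bij_betw_def \<sigma>_def C_def sklyanin_sigma_def)
qed

lemma inv_sigma:
  assumes "p \<in> C"
  shows "inv_into C \<sigma> p = cyclic_shift (cyclic_shift (\<sigma> p))"
  using sigma_bij sigma_inverse[OF assms] by (intro inv_into_f_eq) (auto simp: Bij_def bij_betw_def)

end

lemma hom_poly_fun_quadratic:
  "hom_poly_fun 2 (\<lambda>x y z. a * x^2 + b * y^2 + c * z^2 + d * (x*y) + e * (x*z) + f * (y*z))"
  unfolding hom_poly_fun_def
  by (rule exI[of _ "\<lambda>i j. if i = 2 then a else if j = 2 then b else if i = 1 \<and> j = 1 then d
      else if i = 1 then e else if j = 1 then f else c"])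
    (simp add: numeral_2_eq_2 algebra_simps)

lemma hom_poly_fun_scale:
  assumes "hom_poly_fun d F"
  shows "F (t * x) (t * y) (t * z) = t ^ d * F x y z"
proof -
  from assms obtain coef where
    F: "F x y z = (\<Sum>i\<le>d. \<Sum>j\<le>d - i. coef i j * x ^ i * y ^ j * z ^ (d - i - j))" for x y z
    unfolding hom_poly_fun_def by blast
  have "coef i j * (t * x) ^ i * (t * y) ^ j * (t * z) ^ (d - i - j) =
      t ^ d * (coef i j * x ^ i * y ^ j * z ^ (d - i - j))" if "i \<le> d" "j \<le> d - i" for i j
  proof -
    have "t ^ d = t ^ i * t ^ j * t ^ (d - i - j)" using that by (simp flip: power_add)
    then show ?thesis by (simp only: power_mult_distrib ac_simps)
  qed
  then show ?thesis unfolding F sum_distrib_left by (intro sum.cong refl) simp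
qed

text \<open>Each of the three charts gives \<open>\<sigma>\<close> wherever it does not vanish.\<close>

lemma regular_sigma:
  assumes two: "(2::'k::field) \<noteq> 0"
  shows "regular_map_on (sklyanin_curve (1::'k) (-1) (-1)) (sklyanin_sigma 1 (-1) (-1))"
  unfolding regular_map_on_def
proof
  let ?C = "sklyanin_curve (1::'k) (-1) (-1)" and ?\<sigma> = "sklyanin_sigma (1::'k) (-1) (-1)"
  fix p assume "p \<in> ?C"
  then obtain x y z where p: "p = hpoint x y z" "(x, y, z) \<noteq> (0, 0, 0)"
    by (rule sklyanin_curveE)
  have chart: "\<exists>d F G H. hom_poly_fun d F \<and> hom_poly_fun d G \<and> hom_poly_fun d H \<and>
     (\<forall>(x, y, z)\<in>p. (F x y z, G x y z, H x y z) \<noteq> (0, 0, 0)) \<and>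
     (\<forall>q\<in>?C. \<forall>(x, y, z)\<in>q. (F x y z, G x y z, H x y z) \<noteq> (0, 0, 0) \<longrightarrow>
        ?\<sigma> q = hpoint (F x y z) (G x y z) (H x y z))"
    if nz: "(F x y z, G x y z, H x y z) \<noteq> (0, 0, 0)"
      and inc: "\<And>a b c. curve_coords a b c \<Longrightarrow> incident_coords a b c (F a b c) (G a b c) (H a b c)"
      and hom: "hom_poly_fun 2 F" "hom_poly_fun 2 G" "hom_poly_fun 2 H"
    for F G H
  proof -
    have "(F a b c, G a b c, H a b c) \<noteq> (0, 0, 0)" if "(a, b, c) \<in> p" for a b c
      using that nz by (auto simp: p(1) mem_hpoint_iff hom[THEN hom_poly_fun_scale])
    moreover have "?\<sigma> q = hpoint (F a b c) (G a b c) (H a b c)"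
      if q: "q \<in> ?C" "(a, b, c) \<in> q" and nz': "(F a b c, G a b c, H a b c) \<noteq> (0, 0, 0)" for q a b c
    proof -
      obtain a' b' c' t where "q = hpoint a' b' c'" "(a', b', c') \<noteq> (0, 0, 0)"
          "t \<noteq> 0" "a = t * a'" "b = t * b'" "c = t * c'"
        using q by (elim sklyanin_curveE) (auto simp: mem_hpoint_iff)
      then have q': "q = hpoint a b c" "(a, b, c) \<noteq> (0, 0, 0)" by (auto simp: hpoint_scale)
      with q have "curve_coords a b c" by (simp add: sklyanin_curve_iff)
      with sigma_eqI[OF two q'(2) nz'] inc show ?thesis by (simp add: q'(1))
    qed
    ultimately show ?thesis using hom by (intro exI[of _ 2] exI[of _ F] exI[of _ G] exI[of _ H]) auto
  qed
  have hom: "hom_poly_fun 2 (\<lambda>x y z. y^2 + x*z :: 'k)" "hom_poly_fun 2 (\<lambda>x y z. y*z - x^2 :: 'k)"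
    "hom_poly_fun 2 (\<lambda>x y z. z^2 + x*y :: 'k)" "hom_poly_fun 2 (\<lambda>x y z. x^2 + y*z :: 'k)"
    "hom_poly_fun 2 (\<lambda>x y z. x*z - y^2 :: 'k)" "hom_poly_fun 2 (\<lambda>x y z. x*y - z^2 :: 'k)"
    using hom_poly_fun_quadratic[of 0 1 0 0 1 0] hom_poly_fun_quadratic[of "-1" 0 0 0 0 1]
      hom_poly_fun_quadratic[of 0 0 1 1 0 0] hom_poly_fun_quadratic[of 1 0 0 0 0 1]
      hom_poly_fun_quadratic[of 0 "-1" 0 0 1 0] hom_poly_fun_quadratic[of 0 0 "-1" 1 0 0]
    by simp_all
  from charts_cover[OF two p(2)]
  show "\<exists>d F G H. hom_poly_fun d F \<and> hom_poly_fun d G \<and> hom_poly_fun d H \<and>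
     (\<forall>(x, y, z)\<in>p. (F x y z, G x y z, H x y z) \<noteq> (0, 0, 0)) \<and>
     (\<forall>q\<in>?C. \<forall>(x, y, z)\<in>q. (F x y z, G x y z, H x y z) \<noteq> (0, 0, 0) \<longrightarrow>
        ?\<sigma> q = hpoint (F x y z) (G x y z) (H x y z))"
  proof (elim disjE)
    assume "(y^2 + x*z, y*z - x^2, z^2 + x*y) \<noteq> (0, 0, 0)"
    then show ?thesis
      by (rule chart[of "\<lambda>x y z. y^2 + x*z" "\<lambda>x y z. y*z - x^2" "\<lambda>x y z. z^2 + x*y",
            OF _ incident_charts(1) hom(1,2,3)])
  next
    assume "(x^2 + y*z, z^2 + x*y, x*z - y^2) \<noteq> (0, 0, 0)"
    then show ?thesis
      by (rule chart[of "\<lambda>x y z. x^2 + y*z" "\<lambda>x y z. z^2 + x*y" "\<lambda>x y z. x*z - y^2",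
            OF _ incident_charts(2) hom(4,3,5)])
  next
    assume "(x*y - z^2, y^2 + x*z, x^2 + y*z) \<noteq> (0, 0, 0)"
    then show ?thesis
      by (rule chart[of "\<lambda>x y z. x*y - z^2" "\<lambda>x y z. y^2 + x*z" "\<lambda>x y z. x^2 + y*z",
            OF _ incident_charts(3) hom(6,1,4)])
  qed
qed

lemma regular_map_on_cyclic_shift:
  assumes "regular_map_on C f"
  shows "regular_map_on C (\<lambda>p. cyclic_shift (f p))"
  unfolding regular_map_on_def
proof
  fix p assume "p \<in> C"
  from assms[unfolded regular_map_on_def, THEN bspec, OF this]
  show "\<exists>d F G H. hom_poly_fun d F \<and> hom_poly_fun d G \<and> hom_poly_fun d H \<and>
     (\<forall>(x, y, z)\<in>p. (F x y z, G x y z, H x y z) \<noteq> (0, 0, 0)) \<and>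
     (\<forall>q\<in>C. \<forall>(x, y, z)\<in>q. (F x y z, G x y z, H x y z) \<noteq> (0, 0, 0) \<longrightarrow>
        cyclic_shift (f q) = hpoint (F x y z) (G x y z) (H x y z))"
  proof (elim exE conjE)
    fix d F G H
    assume hom: "hom_poly_fun d F" "hom_poly_fun d G" "hom_poly_fun d H"
      and nz: "\<forall>(x, y, z)\<in>p. (F x y z, G x y z, H x y z) \<noteq> (0, 0, 0)"
      and f: "\<forall>q\<in>C. \<forall>(x, y, z)\<in>q. (F x y z, G x y z, H x y z) \<noteq> (0, 0, 0) \<longrightarrow>
        f q = hpoint (F x y z) (G x y z) (H x y z)"
    have "(G x y z, H x y z, F x y z) \<noteq> (0, 0, 0)" if "(x, y, z) \<in> p" for x y z
      using bspec[OF nz that] by auto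
    moreover have "cyclic_shift (f q) = hpoint (G x y z) (H x y z) (F x y z)"
      if "q \<in> C" "(x, y, z) \<in> q" "(G x y z, H x y z, F x y z) \<noteq> (0, 0, 0)" for q x y z
    proof -
      have "f q = hpoint (F x y z) (G x y z) (H x y z)"
        using bspec[OF bspec[OF f that(1)] that(2)] that(3) by auto
      then show ?thesis by (simp add: cyclic_shift_hpoint)
    qed
    ultimately show ?thesis
      using hom by (intro exI[of _ d] exI[of _ G] exI[of _ H] exI[of _ F]) blast
  qed
qed

lemma sigma_curve_aut:
  assumes two: "(2::'k::field) \<noteq> 0"
  shows "sklyanin_sigma (1::'k) (-1) (-1) \<in> curve_aut (sklyanin_curve 1 (-1) (-1))"
proof -
  \<comment> \<open>The inverse \<open>\<rho>\<^sup>2 \<sigma>\<close> is regular because \<open>\<rho>\<close> only permutes coordinates.\<close>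
  have "regular_map_on (sklyanin_curve (1::'k) (-1) (-1))
      (inv_into (sklyanin_curve 1 (-1) (-1)) (sklyanin_sigma 1 (-1) (-1)))"
    using regular_map_on_cyclic_shift[OF regular_map_on_cyclic_shift[OF regular_sigma[OF two]]]
    unfolding regular_map_on_def by (simp add: inv_sigma[OF two])
  then show ?thesis by (simp add: curve_aut_def sigma_bij[OF two] regular_sigma[OF two])
qed

lemma carrier_BijGroup: "carrier (BijGroup S) = Bij S"
  by (simp add: BijGroup_def)

lemma one_BijGroup: "\<one>\<^bsub>BijGroup S\<^esub> = (\<lambda>x\<in>S. x)"
  by (simp add: BijGroup_def)

lemma mult_BijGroup_apply:
  "f \<in> Bij S \<Longrightarrow> g \<in> Bij S \<Longrightarrow> x \<in> S \<Longrightarrow> (f \<otimes>\<^bsub>BijGroup S\<^esub> g) x = f (g x)"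
  by (simp add: BijGroup_def compose_def)

lemma BijGroup_pow_apply:
  assumes "f \<in> Bij S" "p \<in> S"
  shows "(f [^]\<^bsub>BijGroup S\<^esub> (n::nat)) p = (f ^^ n) p"
  using assms(2)
proof (induction n arbitrary: p)
  case 0
  then show ?case by (simp add: one_BijGroup)
next
  case (Suc n)
  interpret group "BijGroup S" by (rule group_BijGroup)
  have "f [^]\<^bsub>BijGroup S\<^esub> n \<in> Bij S"
    using nat_pow_closed[of f n] assms(1) unfolding carrier_BijGroup .
  moreover have "f p \<in> S" using assms(1) Suc.prems by (auto dest: Bij_imp_funcset)
  ultimately have "(f [^]\<^bsub>BijGroup S\<^esub> Suc n) p = (f ^^ n) (f p)"
    using assms(1) Suc by (simp only: nat_pow_Suc mult_BijGroup_apply)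
  then show ?case by (simp add: funpow_swap1)
qed

lemma ord_sigma:
  assumes two: "(2::'k::field) \<noteq> 0"
  shows "group.ord (BijGroup (sklyanin_curve (1::'k) (-1) (-1))) (sklyanin_sigma 1 (-1) (-1)) = 6"
proof -
  let ?C = "sklyanin_curve (1::'k) (-1) (-1)" and ?\<sigma> = "sklyanin_sigma (1::'k) (-1) (-1)"
  interpret group "BijGroup ?C" by (rule group_BijGroup)
  have carr: "?\<sigma> \<in> carrier (BijGroup ?C)" using sigma_bij[OF two] by (simp only: carrier_BijGroup)
  note sq = sigma_sigma[OF two]
  have pow: "(?\<sigma> [^]\<^bsub>BijGroup ?C\<^esub> n) p = (?\<sigma> ^^ n) p" if "p \<in> ?C" for n :: nat and p
    using BijGroup_pow_apply[OF sigma_bij[OF two] that] .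
  have one: "\<one>\<^bsub>BijGroup ?C\<^esub> p = p" if "p \<in> ?C" for p using that by (simp add: one_BijGroup)
  have "?\<sigma> [^]\<^bsub>BijGroup ?C\<^esub> (6::nat) = \<one>\<^bsub>BijGroup ?C\<^esub>"
  proof (rule extensionalityI[of _ ?C])
    show "?\<sigma> [^]\<^bsub>BijGroup ?C\<^esub> (6::nat) \<in> extensional ?C"
      using nat_pow_closed[OF carr, of 6] unfolding carrier_BijGroup by (rule Bij_imp_extensional)
    show "\<one>\<^bsub>BijGroup ?C\<^esub> \<in> extensional ?C" by (simp add: one_BijGroup)
    fix p assume p: "p \<in> ?C"
    have step: "?\<sigma> (?\<sigma> q) = cyclic_shift q" "cyclic_shift q \<in> ?C" if "q \<in> ?C" for q
      using sq that by (simp, metis)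
    have "(?\<sigma> ^^ 6) p = p"
      using p by (simp add: eval_nat_numeral step cyclic_shift_cubed)
    with p show "(?\<sigma> [^]\<^bsub>BijGroup ?C\<^esub> (6::nat)) p = \<one>\<^bsub>BijGroup ?C\<^esub> p" by (simp add: pow one)
  qed
  then have dvd6: "ord ?\<sigma> dvd 6" using pow_eq_id[OF carr] by blast
  \<comment> \<open>The orbit of \<open>[0 : 1 : -1]\<close> passes through \<open>[1 : -1 : 0]\<close> after two steps and
    \<open>[1 : -1 : -1]\<close> after three, which excludes the proper divisors of 6.\<close>
  define O1 :: "('k \<times> 'k \<times> 'k) set" where "O1 = hpoint 0 1 (-1)"
  have O1: "O1 \<in> ?C" by (simp add: O1_def sklyanin_curve_iff curve_coords_def)
  have two': "?\<sigma> (?\<sigma> O1) = hpoint 1 (-1) 0" using sq[OF O1] by (simp add: O1_def cyclic_shift_hpoint)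
  have three': "?\<sigma> (hpoint 1 (-1) 0) = hpoint 1 (-1) (-1)"
    by (rule sigma_eqI[OF two]) (simp_all add: incident_coords_def)
  have ne: "hpoint 1 (-1) 0 \<noteq> O1" "hpoint 1 (-1) (-1) \<noteq> O1"
  proof -
    have "(1, -1, 0::'k) \<in> hpoint 1 (-1) 0" "(1, -1, -1::'k) \<in> hpoint 1 (-1) (-1)"
      by (rule hpoint_self, simp)+
    moreover have "(1, -1, 0) \<notin> O1" "(1, -1, -1) \<notin> O1" by (simp_all add: O1_def mem_hpoint_iff)
    ultimately show "hpoint 1 (-1) 0 \<noteq> O1" "hpoint 1 (-1) (-1) \<noteq> O1" by metis+
  qed
  have "\<not> ord ?\<sigma> dvd 2"
  proof
    assume "ord ?\<sigma> dvd 2"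
    then have "?\<sigma> [^]\<^bsub>BijGroup ?C\<^esub> (2::nat) = \<one>\<^bsub>BijGroup ?C\<^esub>" using pow_eq_id[OF carr] by blast
    with pow[OF O1, of 2] one[OF O1] two' ne show False by (simp add: eval_nat_numeral)
  qed
  moreover have "\<not> ord ?\<sigma> dvd 3"
  proof
    assume "ord ?\<sigma> dvd 3"
    then have "?\<sigma> [^]\<^bsub>BijGroup ?C\<^esub> (3::nat) = \<one>\<^bsub>BijGroup ?C\<^esub>" using pow_eq_id[OF carr] by blast
    with pow[OF O1, of 3] one[OF O1] two' three' ne show False by (simp add: eval_nat_numeral)
  qed
  moreover have "d = 6" if "d dvd 6" "\<not> d dvd 2" "\<not> d dvd 3" for d :: nat
  proof -
    have "d \<le> 6" using that(1) by (auto dest: dvd_imp_le)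
    then have "d \<in> {0, 1, 2, 3, 4, 5, 6}" by auto
    with that show ?thesis by auto
  qed
  ultimately show ?thesis using dvd6 by blast
qed

section \<open>Evaluating noncommutative polynomials at matrices\<close>

lemma smult_smult_mat: "s \<cdot>\<^sub>m (t \<cdot>\<^sub>m A) = (s * t) \<cdot>\<^sub>m (A :: 'k::field mat)"
  by (rule eq_matI) (simp_all add: mult.assoc)

definition word_eval :: "nat \<Rightarrow> (gen \<Rightarrow> 'k::field mat) \<Rightarrow> word \<Rightarrow> 'k mat" where
  "word_eval n M w = foldr (\<lambda>g A. M g * A) (letters w) (1\<^sub>m n)"

text \<open>The algebra homomorphism from the free algebra that extends \<open>M\<close>.  It is given by its
  entries because matrices of varying size do not form a type of class
  \<^class>\<open>comm_monoid_add\<close>, so that they cannot be summed directly.\<close>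

definition free_eval :: "nat \<Rightarrow> (gen \<Rightarrow> 'k::field mat) \<Rightarrow> 'k free_alg \<Rightarrow> 'k mat" where
  "free_eval n M f = Matrix.mat n n (\<lambda>(i, j). \<Sum>w\<in>Poly_Mapping.keys f.
     Poly_Mapping.lookup f w * word_eval n M w $$ (i, j))"

lemma free_eval_carrier [simp]: "free_eval n M f \<in> carrier_mat n n"
  by (simp add: free_eval_def)

lemma free_eval_superset:
  assumes "finite K" "Poly_Mapping.keys f \<subseteq> K"
  shows "free_eval n M f = Matrix.mat n n (\<lambda>(i, j). \<Sum>w\<in>K.
     Poly_Mapping.lookup f w * word_eval n M w $$ (i, j))"
  unfolding free_eval_def using assms
  by (intro cong_mat) (auto intro!: sum.mono_neutral_left simp: in_keys_iff)

lemma free_eval_add: "free_eval n M (f + g) = free_eval n M f + free_eval n M g"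
proof -
  let ?K = "Poly_Mapping.keys f \<union> Poly_Mapping.keys g"
  have "Poly_Mapping.keys (f + g) \<subseteq> ?K" by (rule Poly_Mapping.keys_add)
  then show ?thesis
    by (subst (1 2 3) free_eval_superset[of ?K])
      (auto simp: lookup_add sum.distrib algebra_simps)
qed

context
  fixes n :: nat and M :: "gen \<Rightarrow> 'k::field mat"
  assumes M: "\<And>g. M g \<in> carrier_mat n n"
begin

lemma word_eval_carrier: "word_eval n M w \<in> carrier_mat n n"
proof -
  have "foldr (\<lambda>g A. M g * A) gs (1\<^sub>m n) \<in> carrier_mat n n" for gs
    by (induction gs) (auto intro: mult_carrier_mat M)
  then show ?thesis by (simp add: word_eval_def)
qed

lemma word_eval_add: "word_eval n M (u + v) = word_eval n M u * word_eval n M v"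
proof -
  have "word_eval n M (Word (gs @ letters v)) = word_eval n M (Word gs) * word_eval n M v" for gs
  proof (induction gs)
    case Nil
    show ?case using word_eval_carrier[of v] by (simp add: word_eval_def)
  next
    case (Cons g gs)
    then show ?case
      using assoc_mult_mat[OF M[of g] word_eval_carrier[of "Word gs"] word_eval_carrier[of v]]
      by (simp add: word_eval_def)
  qed
  from this[of "letters u"] show ?thesis by (simp add: plus_word_def)
qed

lemma free_eval_single: "free_eval n M (Poly_Mapping.single w t) = t \<cdot>\<^sub>m word_eval n M w"
  using word_eval_carrier[of w]
  by (subst free_eval_superset[of "{w}"]) (auto intro!: eq_matI)

text \<open>By additivity in both factors it suffices to multiply monomials, where the product of
  words is concatenation.\<close>

lemma free_eval_mult: "free_eval n M (f * g) = free_eval n M f * free_eval n M g"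
proof -
  \<comment> \<open>One step of the induction over finitely supported functions adds a monomial.\<close>
  have split: "Poly_Mapping.update a b f = Poly_Mapping.single a b + f"
    if "a \<notin> Poly_Mapping.keys f" for a b and f :: "'k free_alg"
    using that
    by (intro poly_mapping_eqI) (auto simp: lookup_update lookup_add lookup_single when_def in_keys_iff)
  have zero: "free_eval n M 0 = 0\<^sub>m n n" by (auto simp: free_eval_def intro!: eq_matI)
  have single: "free_eval n M (Poly_Mapping.single a b * g) =
      free_eval n M (Poly_Mapping.single a b) * free_eval n M g" for a b g
  proof (induction g rule: update_induct)
    case const
    show ?case by (simp add: zero right_mult_zero_mat[OF free_eval_carrier])
  next
    case (update g c d)
    have mono: "free_eval n M (Poly_Mapping.single a b * Poly_Mapping.single c d) =
        free_eval n M (Poly_Mapping.single a b) * free_eval n M (Poly_Mapping.single c d)"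
      using mult_smult_assoc_mat[OF word_eval_carrier[of a], of "d \<cdot>\<^sub>m word_eval n M c" n b]
        mult_smult_distrib[OF word_eval_carrier[of a] word_eval_carrier[of c], of d]
        word_eval_carrier[of c]
      by (simp add: mult_single free_eval_single word_eval_add smult_smult_mat)
    show ?case
      using update
      by (simp add: split distrib_left free_eval_add mono mult_add_distrib_mat[of _ n n _ n])
  qed
  show ?thesis
  proof (induction f rule: update_induct)
    case const
    show ?case by (simp add: zero left_mult_zero_mat[OF free_eval_carrier])
  next
    case (update f a b)
    then show ?case
      by (simp add: split distrib_right free_eval_add single add_mult_distrib_mat[of _ n n _ _ n])
  qed
qed

lemma free_eval_one: "free_eval n M 1 = 1\<^sub>m n"
  unfolding single_one[symmetric] free_eval_single
  by (auto simp: word_eval_def zero_word_def intro!: eq_matI)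

lemma free_eval_scalar: "free_eval n M (free_scalar t) = t \<cdot>\<^sub>m 1\<^sub>m n"
  by (simp add: free_scalar_def free_eval_single word_eval_def zero_word_def)

lemma free_eval_gen: "free_eval n M (free_gen g) = M g"
  using M[of g] by (auto simp: free_gen_def free_eval_single word_eval_def intro!: eq_matI)

lemma free_eval_hom: "ring_hom_ring free_ring (ring_mat TYPE('k) n ()) (free_eval n M)"
  by (intro ring_hom_ringI class_ring.ring_axioms ring_mat)
    (simp_all add: ring_mat_simps free_eval_add free_eval_mult free_eval_one)

end

lemma ring_hom_zero_on_genideal:
  assumes "ring_hom_ring R S h" "X \<subseteq> carrier R" "\<And>x. x \<in> X \<Longrightarrow> h x = \<zero>\<^bsub>S\<^esub>" "r \<in> genideal R X"
  shows "h r = \<zero>\<^bsub>S\<^esub>"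
proof -
  interpret ring_hom_ring R S h by fact
  have "genideal R X \<subseteq> a_kernel R S h"
  proof (rule R.genideal_minimal[OF kernel_is_ideal])
    show "X \<subseteq> a_kernel R S h" using assms(2,3) unfolding a_kernel_def' by blast
  qed
  with assms(4) show ?thesis unfolding a_kernel_def' by blast
qed

text \<open>A homomorphism that kills an ideal is constant on its cosets, so the image of a coset is a
  singleton whose element is the value of the induced homomorphism.\<close>

lemma the_elem_image_coset:
  assumes "ring_hom_ring R S h" "ideal I R" "\<And>r. r \<in> I \<Longrightarrow> h r = \<zero>\<^bsub>S\<^esub>" "r \<in> carrier R"
  shows "the_elem (h ` (I +>\<^bsub>R\<^esub> r)) = h r"
proof -
  interpret ring_hom_ring R S h by fact
  interpret ideal I R by fact
  have same: "h x = h r" if "x \<in> I +>\<^bsub>R\<^esub> r" for x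
    using that assms(3,4) by (auto simp: a_r_coset_def r_coset_def)
  have "h ` (I +>\<^bsub>R\<^esub> r) = (\<lambda>_. h r) ` (I +>\<^bsub>R\<^esub> r)" using same by (rule image_cong[OF refl])
  also have "\<dots> = {h r}" using a_rcos_self[OF assms(4)] by (rule image_constant)
  finally show ?thesis by (simp only: the_elem_eq)
qed

lemma ring_hom_factors_through_quotient:
  assumes "ring_hom_ring R S h" "ideal I R" "\<And>r. r \<in> I \<Longrightarrow> h r = \<zero>\<^bsub>S\<^esub>"
  shows "(\<lambda>X. the_elem (h ` X)) \<in> Ring.ring_hom (R Quot I) S"
proof -
  interpret ring_hom_ring R S h by fact
  interpret ideal I R by fact
  note eval = the_elem_image_coset[OF assms]
  have coset: "\<exists>r\<in>carrier R. X = I +>\<^bsub>R\<^esub> r" if "X \<in> carrier (R Quot I)" for X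
    using that by (auto simp: FactRing_simps)
  show ?thesis
  proof (rule ring_hom_memI)
    fix X assume "X \<in> carrier (R Quot I)"
    then show "the_elem (h ` X) \<in> carrier S" using coset eval by fastforce
  next
    fix X Y assume "X \<in> carrier (R Quot I)" "Y \<in> carrier (R Quot I)"
    then obtain x y where xy: "x \<in> carrier R" "X = I +>\<^bsub>R\<^esub> x" "y \<in> carrier R" "Y = I +>\<^bsub>R\<^esub> y"
      using coset by blast
    have "X \<otimes>\<^bsub>R Quot I\<^esub> Y = I +>\<^bsub>R\<^esub> (x \<otimes>\<^bsub>R\<^esub> y)" "X \<oplus>\<^bsub>R Quot I\<^esub> Y = I +>\<^bsub>R\<^esub> (x \<oplus>\<^bsub>R\<^esub> y)"
      using xy rcoset_mult_add a_rcos_sum by (simp_all add: FactRing_def)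
    with xy show "the_elem (h ` (X \<otimes>\<^bsub>R Quot I\<^esub> Y)) = the_elem (h ` X) \<otimes>\<^bsub>S\<^esub> the_elem (h ` Y)"
      and "the_elem (h ` (X \<oplus>\<^bsub>R Quot I\<^esub> Y)) = the_elem (h ` X) \<oplus>\<^bsub>S\<^esub> the_elem (h ` Y)"
      by (simp_all add: eval)
  next
    show "the_elem (h ` \<one>\<^bsub>R Quot I\<^esub>) = \<one>\<^bsub>S\<^esub>" by (simp add: FactRing_def eval)
  qed
qed

text \<open>Matrices that satisfy the relations define a representation.  The second conclusion lets
  invariance under the algebra be tested on these matrices.\<close>

lemma representation_from_matrices:
  fixes M :: "gen \<Rightarrow> 'k::field mat"
  assumes M: "\<And>g. M g \<in> carrier_mat n n"
    and rel: "\<And>r. r \<in> sklyanin_relations a b c \<Longrightarrow> free_eval n M r = 0\<^sub>m n n"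
  obtains \<phi> where "matrix_representation (sklyanin_alg a b c) (sklyanin_scalar a b c) n \<phi>"
    "\<And>g. \<exists>r\<in>carrier (sklyanin_alg a b c). \<phi> r = M g"
proof -
  let ?I = "sklyanin_ideal a b c"
  note hom = free_eval_hom[OF M]
  have ideal: "ideal ?I free_ring"
    unfolding sklyanin_ideal_def by (rule ring.genideal_ideal[OF class_ring.ring_axioms]) simp
  have ker: "free_eval n M r = \<zero>\<^bsub>ring_mat TYPE('k) n ()\<^esub>" if "r \<in> ?I" for r
    using that unfolding sklyanin_ideal_def
    by (rule ring_hom_zero_on_genideal[OF hom, rotated 2]) (simp_all add: rel ring_mat_simps)
  have eval: "the_elem (free_eval n M ` (?I +>\<^bsub>free_ring\<^esub> r)) = free_eval n M r" for r
    by (rule the_elem_image_coset[OF hom ideal ker]) simp_all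
  let ?\<phi> = "\<lambda>X. the_elem (free_eval n M ` X)"
  have "matrix_representation (sklyanin_alg a b c) (sklyanin_scalar a b c) n ?\<phi>"
    unfolding matrix_representation_def sklyanin_alg_def sklyanin_scalar_def
    using ring_hom_factors_through_quotient[OF hom ideal ker] eval free_eval_scalar[OF M] by simp
  moreover have "\<exists>r\<in>carrier (sklyanin_alg a b c). ?\<phi> r = M g" for g
  proof
    show "?\<phi> (?I +>\<^bsub>free_ring\<^esub> free_gen g) = M g" by (simp add: eval free_eval_gen[OF M])
    show "?I +>\<^bsub>free_ring\<^esub> free_gen g \<in> carrier (sklyanin_alg a b c)"
      unfolding sklyanin_alg_def by (rule ring_hom_closed[OF ideal.rcos_ring_hom[OF ideal]]) simp
  qed
  ultimately show thesis by (rule that)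
qed

section \<open>The quaternion representation\<close>

definition mat2 :: "'k \<Rightarrow> 'k \<Rightarrow> 'k \<Rightarrow> 'k \<Rightarrow> 'k mat" where
  "mat2 a b c d = Matrix.mat 2 2 (\<lambda>(i, j). if i = 0 then if j = 0 then a else b else if j = 0 then c else d)"

definition vec2 :: "'k \<Rightarrow> 'k \<Rightarrow> 'k vec" where
  "vec2 u v = Matrix.vec 2 (\<lambda>i. if i = 0 then u else v)"

lemma mat2_carrier [simp]: "mat2 a b c d \<in> carrier_mat 2 2"
  by (simp add: mat2_def)

lemma mat2_simps:
  fixes a b c d :: "'k::field"
  shows "mat2 a b c d * mat2 a' b' c' d' =
      mat2 (a*a' + b*c') (a*b' + b*d') (c*a' + d*c') (c*b' + d*d')"
    and "mat2 a b c d + mat2 a' b' c' d' = mat2 (a+a') (b+b') (c+c') (d+d')"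
    and "t \<cdot>\<^sub>m mat2 a b c d = mat2 (t*a) (t*b) (t*c) (t*d)"
    and "1\<^sub>m 2 = mat2 1 0 0 (1::'k)" and "0\<^sub>m 2 2 = mat2 0 0 0 (0::'k)"
    and "mat2 a b c d *\<^sub>v vec2 u v = vec2 (a*u + b*v) (c*u + d*v)"
    and "vec2 u v + vec2 u' v' = vec2 (u + u') (v + v')"
    and "t \<cdot>\<^sub>v vec2 u v = vec2 (t*u) (t*v)" and "0\<^sub>v 2 = vec2 0 (0::'k)"
  by (auto simp: mat2_def vec2_def scalar_prod_def numeral_2_eq_2 intro!: eq_matI eq_vecI)

lemma vec2_cases:
  assumes "w \<in> carrier_vec 2"
  obtains u v where "w = vec2 u v"
proof
  show "w = vec2 (w $ 0) (w $ 1)"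
    using assms by (intro eq_vecI) (auto simp: vec2_def less_2_cases_iff)
qed

text \<open>For \<open>i\<^sup>2 = -1\<close> these are \<open>1 + I\<close>, \<open>1 + J\<close> and \<open>1 + K\<close> with the quaternion units
  \<open>I = diag(i, -i)\<close>, \<open>J = (0 1; -1 0)\<close> and \<open>K = I J\<close>.\<close>

fun quaternion_matrix :: "'k::field \<Rightarrow> gen \<Rightarrow> 'k mat" where
  "quaternion_matrix i Gen_x = mat2 (1 + i) 0 0 (1 - i)"
| "quaternion_matrix i Gen_y = mat2 1 1 (-1) 1"
| "quaternion_matrix i Gen_z = mat2 1 i i 1"

lemma quaternion_matrix_carrier: "quaternion_matrix i g \<in> carrier_mat 2 2"
  by (cases g) simp_all

lemma quaternion_matrix_relations:
  assumes "i * i = - 1" "r \<in> sklyanin_relations 1 (-1) (-1)"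
  shows "free_eval 2 (quaternion_matrix i) r = 0\<^sub>m 2 2"
proof -
  have i: "i * (i * x) = - x" for x using assms(1) by (simp flip: mult.assoc)
  note ev = free_eval_mult[OF quaternion_matrix_carrier] free_eval_gen[OF quaternion_matrix_carrier]
    free_eval_scalar[OF quaternion_matrix_carrier] free_eval_add
  from assms(2) show ?thesis
    unfolding sklyanin_relations_def Let_def
    by (auto simp: ev power2_eq_square mat2_simps algebra_simps assms(1) i)
qed

text \<open>The matrix of \<open>x\<close> is diagonal with distinct eigenvalues when \<open>2 \<noteq> 0\<close>, so an invariant
  subspace contains both coordinate projections of each of its vectors; the matrix of \<open>y\<close> then
  moves a vector on either coordinate axis to one with a component along the other axis.\<close>

lemma quaternion_invariant_subspace:
  fixes i :: "'k::field"
  assumes two: "(2::'k) \<noteq> 0" and i: "i * i = -1"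
    and W: "VectorSpace.subspace class_ring W (module_vec TYPE('k) 2)"
    and inv: "\<And>g w. w \<in> W \<Longrightarrow> quaternion_matrix i g *\<^sub>v w \<in> W"
  shows "W = {0\<^sub>v 2} \<or> W = carrier_vec 2"
proof (rule disjCI)
  interpret W: submodule "class_ring :: 'k ring" W "module_vec TYPE('k) 2"
    using W by (simp add: VectorSpace.subspace_def)
  define P where "P u v \<longleftrightarrow> vec2 u v \<in> W" for u v
  have sub: "W \<subseteq> carrier_vec 2" using W.subset by (simp add: module_vec_simps)
  have zero: "0\<^sub>v 2 \<in> W" using W.zero_closed by (simp add: module_vec_simps)
  have add: "P (u + u') (v + v')" if "P u v" "P u' v'" for u v u' v'
    using that W.m_closed by (auto simp: P_def module_vec_simps simp flip: mat2_simps)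
  have scale: "P (t * u) (t * v)" if "P u v" for t u v
    using that W.smult_closed by (auto simp: P_def module_vec_simps simp flip: mat2_simps)
  have x: "P ((1 + i) * u) ((1 - i) * v)" if "P u v" for u v
    using that inv[of "vec2 u v" Gen_x] by (simp add: P_def mat2_simps)
  have y: "P (u + v) (v - u)" if "P u v" for u v
    using that inv[of "vec2 u v" Gen_y] by (simp add: P_def mat2_simps)
  have project: "P u 0" "P 0 v" if "P u v" for u v
  proof -
    have "P ((1 + i) * u + (-1) * u) ((1 - i) * v + (-1) * v)" using add x scale that by blast
    then have "P (i * u) (- i * v)" by (simp add: algebra_simps)
    \<comment> \<open>So far \<open>I = x - 1\<close> was applied; scaling by \<open>-i\<close> gives the reflection \<open>diag(1, -1)\<close>.\<close>
    from scale[OF this, of "- i"] have flip: "P u (- v)" using i by (simp flip: mult.assoc)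
    have "P (2 * u) 0" using add[OF that flip] by simp
    from scale[OF this, of "1/2"] show "P u 0" using two by simp
    have "P 0 (2 * v)" using add[OF that scale[OF flip, of "-1"]] by simp
    from scale[OF this, of "1/2"] show "P 0 v" using two by simp
  qed
  assume "W \<noteq> carrier_vec 2"
  show "W = {0\<^sub>v 2}"
  proof (rule ccontr)
    assume "W \<noteq> {0\<^sub>v 2}"
    then obtain u v where uv: "P u v" "u \<noteq> 0 \<or> v \<noteq> 0"
      using zero sub by (metis P_def insertI1 mat2_simps(9) singleton_iff subset_eq subsetI subset_antisym vec2_cases)
    have "P 1 0 \<and> P 0 1"
    proof (cases "u = 0")
      case False
      have e1: "P 1 0" using scale[OF project(1)[OF uv(1)], of "1 / u"] False by simp
      have "P 0 (-1)" using project(2)[OF y[OF e1]] by simp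
      from e1 scale[OF this, of "-1"] show ?thesis by simp
    next
      case True
      have e2: "P 0 1" using scale[OF project(2)[OF uv(1)], of "1 / v"] True uv(2) by simp
      have "P 1 0" using project(1)[OF y[OF e2]] by simp
      with e2 show ?thesis by simp
    qed
    then have "P u v" for u v using add[OF scale[of 1 0 u] scale[of 0 1 v]] by simp
    then have "carrier_vec 2 \<subseteq> W" by (metis P_def subsetI vec2_cases)
    with sub \<open>W \<noteq> carrier_vec 2\<close> show False by blast
  qed
qed

lemma irreducible_representation_exists:
  assumes two: "(2::'k::alg_closed_field) \<noteq> 0"
  shows "\<exists>\<phi>. irreducible_representation (sklyanin_alg (1::'k) (-1) (-1))
      (sklyanin_scalar 1 (-1) (-1)) 2 \<phi>"
proof -
  obtain i :: 'k where "i ^ 2 = -1" using nth_root_exists[of 2 "-1"] by auto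
  then have i: "i * i = -1" by (simp add: power2_eq_square)
  obtain \<phi> where
    rep: "matrix_representation (sklyanin_alg 1 (-1) (-1)) (sklyanin_scalar 1 (-1) (-1)) 2 \<phi>"
    and gens: "\<And>g. \<exists>r\<in>carrier (sklyanin_alg 1 (-1) (-1)). \<phi> r = quaternion_matrix i g"
    using representation_from_matrices[OF quaternion_matrix_carrier quaternion_matrix_relations[OF i]]
    by metis
  have "W = {0\<^sub>v 2} \<or> W = carrier_vec 2"
    if W: "VectorSpace.subspace class_ring W (module_vec TYPE('k) 2)"
      and inv: "\<forall>r\<in>carrier (sklyanin_alg 1 (-1) (-1)). \<forall>w\<in>W. \<phi> r *\<^sub>v w \<in> W" for W
  proof (rule quaternion_invariant_subspace[OF two i W])
    fix g w assume "w \<in> W"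
    obtain r where "r \<in> carrier (sklyanin_alg 1 (-1) (-1))" "\<phi> r = quaternion_matrix i g"
      using gens by blast
    with inv \<open>w \<in> W\<close> show "quaternion_matrix i g *\<^sub>v w \<in> W" by metis
  qed
  with rep show ?thesis
    unfolding irreducible_representation_def by (intro exI[of _ \<phi>]) simp
qed

theorem proposition1p4:
  assumes "CHAR('k::alg_closed_field) \<noteq> 2" and "CHAR('k) \<noteq> 3"
  shows "(sklyanin_params (1::'k) (-1) (-1) \<longleftrightarrow> CHAR('k) \<noteq> 7) \<and>
    (sklyanin_params (1::'k) (-1) (-1) \<longrightarrow>
      sklyanin_sigma (1::'k) (-1) (-1) \<in> curve_aut (sklyanin_curve 1 (-1) (-1)) \<and>
      group.ord (BijGroup (sklyanin_curve (1::'k) (-1) (-1))) (sklyanin_sigma 1 (-1) (-1)) = 6 \<and>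
      (\<exists>\<phi>. irreducible_representation (sklyanin_alg (1::'k) (-1) (-1))
             (sklyanin_scalar 1 (-1) (-1)) 2 \<phi>))"
  using params_iff[OF assms(1)] sigma_curve_aut ord_sigma irreducible_representation_exists
    CHAR_not_2[OF assms(1)] by blast

end
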